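(* For any integer $n\geq 1$, the following hold: (1) $i_{B'}\!\left(n,\binom{n}{2}\right)=2^{n-1}$; (2) $i_{B'}(n,1)=2(n-1)$; (3) $i_{B'}(n,k)$ is even whenever $n\geq 2$ and $k\geq 1$.
   Context: For $n\ge 1$, $B'_n$ denotes the set of overlined permutations of $\{1,\dots,n\}$ of the following kind: an element is a permutation $\sigma=\sigma_1\sigma_2\cdots\sigma_n$ of $\{1,\dots,n\}$ (in one-line notation) in which each entry $\sigma_i$ is independently either overlined or not overlined, subject to the condition that $\sigma_i$ may be overlined only if there is an index $j>i$ with $\sigma_i>\sigma_j$ (overlines are ignored in comparing entries). An inversion of such an element is a pair of positions $i<j$ with $\sigma_i>\sigma_j$, again ignoring overlines. The over-Mahonian number $i_{B'}(n,k)$ is the number of elements of $B'_n$ with exactly $k$ inversions; it is $0$ for integers $k$ outside $0\le k\le\binom n2$. *)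

theory Defs
  imports Complex_Main "HOL-Combinatorics.Multiset_Permutations"
begin

text \<open>
  A permutation with overlines is written as the word of its entries, each entry being a pair
  of its value and a flag that is \<^const>\<open>True\<close> iff the entry is overlined. Positions are list
  indices, hence counted from 0.
\<close>

definition overlined_perms :: "nat \<Rightarrow> (nat \<times> bool) list set" where
  "overlined_perms n =
     {w. map fst w \<in> permutations_of_set {1..n} \<and>
         (\<forall>i<length w. snd (w ! i) \<longrightarrow>
            (\<exists>j<length w. i < j \<and> fst (w ! i) > fst (w ! j)))}"

definition inversions :: "(nat \<times> bool) list \<Rightarrow> (nat \<times> nat) set" where
  "inversions w = {(i, j). i < j \<and> j < length w \<and> fst (w ! i) > fst (w ! j)}"

text \<open>The second argument is an arbitrary integer; outside the range from 0 to
  \<open>n choose 2\<close> the counted set is empty.\<close>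

definition over_mahonian :: "nat \<Rightarrow> int \<Rightarrow> nat" where
  "over_mahonian n k = card {w \<in> overlined_perms n. int (card (inversions w)) = k}"

lemma finite_overlined_perms: "finite (overlined_perms n)"
proof (rule finite_subset)
  show "overlined_perms n \<subseteq> {w. set w \<subseteq> {1..n} \<times> UNIV \<and> length w = n}"
  proof
    fix w assume "w \<in> overlined_perms n"
    then have p: "map fst w \<in> permutations_of_set {1..n}"
      by (simp add: overlined_perms_def)
    then have s: "fst ` set w = {1..n}" and "length (map fst w) = n"
      using permutations_of_setD[OF p] length_finite_permutations_of_set[OF p] by simp_all
    moreover have "set w \<subseteq> fst ` set w \<times> UNIV"
      by force
    ultimately show "w \<in> {w. set w \<subseteq> {1..n} \<times> UNIV \<and> length w = n}" by simp
  qed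
  show "finite {w. set w \<subseteq> {1..n} \<times> (UNIV :: bool set) \<and> length w = n}"
    by (rule finite_lists_length_eq) simp
qed

end

theory Submission
  imports Defs
begin

text \<open>
  Read a word of \<^term>\<open>overlined_perms n\<close> from the left. Its first entry \<open>a\<close> is in inversion with
  exactly the smaller entries, all of which follow it; so if \<open>r\<close> denotes the number of smaller
  entries, then \<open>a\<close> contributes \<open>r\<close> inversions, and it may carry an overline iff \<open>r > 0\<close>. The
  remaining word is again an overlined permutation, of the set with \<open>a\<close> removed, and as \<open>a\<close> ranges
  over the \<open>n\<close> values, \<open>r\<close> takes each of the values \<open>0, \<dots>, n - 1\<close> once. In terms of generating
  functions, \<open>\<Sum>\<^sub>k i(n,k) q\<^sup>k = (\<Sum>\<^sub>k i(n-1,k) q\<^sup>k) (1 + 2q + \<dots> + 2q\<^sup>n\<^sup>-\<^sup>1)\<close>; as a recurrence, this is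
  \<open>over_mahonian_Suc\<close> below.

  All three claims are read off from the recurrence by induction on \<open>n\<close>, starting at
  \<open>n = 1\<close> for the first two. At \<open>k = n choose 2\<close> only
  the largest \<open>r\<close> contributes, and it doubles the previous value. At \<open>k = 1\<close> only \<open>r = 0\<close> and
  \<open>r = 1\<close> contribute, and the second adds 2. Modulo 2 the number does not depend on \<open>n\<close>
  at all, and for \<open>n = 0\<close> it vanishes at every \<open>k \<noteq> 0\<close>.

  Removing an entry leaves gaps in the set of values. So that no relabelling is needed,
  the decomposition is carried out for words over an arbitrary finite set of values.
\<close>

section \<open>Splitting off the first entry of a word\<close>

definition overlines_ok :: "(nat \<times> bool) list \<Rightarrow> bool" where
  "overlines_ok w \<longleftrightarrow> (\<forall>i<length w. snd (w ! i) \<longrightarrow>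
     (\<exists>j<length w. i < j \<and> fst (w ! i) > fst (w ! j)))"

definition overlined_perms_of :: "nat set \<Rightarrow> (nat \<times> bool) list set" where
  "overlined_perms_of A = {w. map fst w \<in> permutations_of_set A \<and> overlines_ok w}"

definition rank :: "nat set \<Rightarrow> nat \<Rightarrow> nat" where
  "rank A a = card {x \<in> A. x < a}"

definition overlined_perms_of_inv :: "nat set \<Rightarrow> int \<Rightarrow> (nat \<times> bool) list set" where
  "overlined_perms_of_inv A k = {w \<in> overlined_perms_of A. int (card (inversions w)) = k}"

lemma over_mahonian_altdef: "over_mahonian n k = card (overlined_perms_of_inv {1..n} k)"
  by (simp add: over_mahonian_def overlined_perms_def overlined_perms_of_inv_def
      overlined_perms_of_def overlines_ok_def)

lemma overlines_ok_Cons: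
  "overlines_ok ((a, b) # w) \<longleftrightarrow> (b \<longrightarrow> (\<exists>y\<in>fst ` set w. y < a)) \<and> overlines_ok w"
proof -
  have "(\<exists>y\<in>fst ` set w. y < a) \<longleftrightarrow> (\<exists>j<length w. fst (w ! j) < a)"
    unfolding set_conv_nth by blast
  then show ?thesis
    by (simp add: overlines_ok_def All_less_Suc2 Ex_less_Suc2)
qed

lemma card_inversions_Cons:
  "card (inversions ((a, b) # w)) = length (filter (\<lambda>y. y < a) (map fst w)) + card (inversions w)"
proof -
  let ?J = "{j. j < length w \<and> fst (w ! j) < a}"
  have eq: "inversions ((a, b) # w)
      = (\<lambda>j. (0, Suc j)) ` ?J \<union> map_prod Suc Suc ` inversions w"
  proof (intro set_eqI)
    fix p :: "nat \<times> nat"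
    obtain i j where p: "p = (i, j)" by (cases p)
    show "p \<in> inversions ((a, b) # w) \<longleftrightarrow>
        p \<in> (\<lambda>j. (0, Suc j)) ` ?J \<union> map_prod Suc Suc ` inversions w"
      unfolding p by (cases i; cases j) (auto simp: inversions_def)
  qed
  have "inversions w \<subseteq> {..<length w} \<times> {..<length w}"
    by (auto simp: inversions_def)
  then have fin: "finite (inversions w)"
    by (rule finite_subset) simp
  have "card (inversions ((a, b) # w))
      = card ((\<lambda>j. (0::nat, Suc j)) ` ?J) + card (map_prod Suc Suc ` inversions w)"
    unfolding eq by (rule card_Un_disjoint) (use fin in auto)
  also have "card ((\<lambda>j. (0::nat, Suc j)) ` ?J) = card ?J"
    by (rule card_image) (auto simp: inj_on_def)
  also have "card (map_prod Suc Suc ` inversions w) = card (inversions w)"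
    by (rule card_image) (auto simp: inj_on_def)
  also have "card ?J = length (filter (\<lambda>y. y < a) (map fst w))"
    by (simp add: length_filter_conv_card cong: conj_cong)
  finally show ?thesis .
qed

lemma finite_overlined_perms_of:
  assumes "finite A"
  shows "finite (overlined_perms_of A)"
proof (rule finite_subset)
  show "overlined_perms_of A \<subseteq> {w. set w \<subseteq> A \<times> UNIV \<and> length w \<le> card A}"
    by (force simp: overlined_perms_of_def dest: permutations_of_setD
        length_finite_permutations_of_set)
  show "finite {w. set w \<subseteq> A \<times> (UNIV :: bool set) \<and> length w \<le> card A}"
    using assms by (intro finite_lists_length_le) auto
qed

lemma Cons_in_overlined_perms_of_inv:
  assumes "finite A"
  shows "(a, b) # w \<in> overlined_perms_of_inv A k \<longleftrightarrow>
    a \<in> A \<and> (b \<longrightarrow> rank A a > 0) \<and> w \<in> overlined_perms_of_inv (A - {a}) (k - int (rank A a))"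
proof (cases "a \<in> A \<and> map fst w \<in> permutations_of_set (A - {a})")
  case True
  then have a: "a \<in> A" and set: "fst ` set w = A - {a}" and dist: "distinct (map fst w)"
    by (auto simp: permutations_of_set_def simp del: set_map simp flip: set_map)
  from True have Cons: "map fst ((a, b) # w) \<in> permutations_of_set A"
    by (auto simp: permutations_of_set_def)
  have smaller: "{x \<in> A. x < a} = {x \<in> fst ` set w. x < a}"
    unfolding set by auto
  have "length (filter (\<lambda>y. y < a) (map fst w)) = card (set (filter (\<lambda>y. y < a) (map fst w)))"
    using dist by (metis distinct_card distinct_filter)
  also have "set (filter (\<lambda>y. y < a) (map fst w)) = {x \<in> A. x < a}"
    unfolding smaller by auto
  finally have len: "length (filter (\<lambda>y. y < a) (map fst w)) = rank A a"
    by (simp add: rank_def)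
  have pos: "(\<exists>y\<in>fst ` set w. y < a) \<longleftrightarrow> rank A a > 0"
    using assms unfolding rank_def smaller by (auto simp: card_gt_0_iff)
  show ?thesis
    using True Cons
    unfolding overlined_perms_of_inv_def overlined_perms_of_def mem_Collect_eq
      overlines_ok_Cons card_inversions_Cons len pos by auto
next
  case False
  then show ?thesis
    by (auto simp: overlined_perms_of_inv_def overlined_perms_of_def permutations_of_set_def)
qed

text \<open>The factor 2 stands for the free choice of an overline on the first entry.\<close>

lemma card_overlined_perms_of_inv_rec:
  assumes "finite A" "A \<noteq> {}"
  shows "card (overlined_perms_of_inv A k) =
    (\<Sum>a\<in>A. (if rank A a = 0 then 1 else 2)
        * card (overlined_perms_of_inv (A - {a}) (k - int (rank A a))))"
proof -
  let ?B = "\<lambda>a. {b. b \<longrightarrow> rank A a > 0}"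
  let ?W = "\<lambda>a. overlined_perms_of_inv (A - {a}) (k - int (rank A a))"
  let ?S = "SIGMA a:A. ?B a \<times> ?W a"
  have fin: "finite (?W a)" for a
    using finite_overlined_perms_of[of "A - {a}"] assms(1)
    by (simp add: overlined_perms_of_inv_def)
  have "overlined_perms_of_inv A k = (\<lambda>(a, b, w). (a, b) # w) ` ?S"
  proof (intro set_eqI)
    fix w
    show "w \<in> overlined_perms_of_inv A k \<longleftrightarrow> w \<in> (\<lambda>(a, b, w). (a, b) # w) ` ?S"
    proof (cases w)
      case Nil
      then show ?thesis
        using assms(2)
        by (auto simp: overlined_perms_of_inv_def overlined_perms_of_def permutations_of_set_def)
    next
      case (Cons x v)
      then show ?thesis
        by (cases x) (auto simp: Cons_in_overlined_perms_of_inv[OF assms(1)] image_iff)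
    qed
  qed
  then have "card (overlined_perms_of_inv A k) = card ?S"
    by (simp add: card_image inj_on_def)
  also have "\<dots> = (\<Sum>a\<in>A. card (?B a \<times> ?W a))"
    using assms(1) fin by (intro card_SigmaI) auto
  also have "\<dots> = (\<Sum>a\<in>A. (if rank A a = 0 then 1 else 2) * card (?W a))"
  proof (intro sum.cong refl)
    fix a
    have "?B a = (if rank A a = 0 then {False} else UNIV)" by auto
    then have "card (?B a) = (if rank A a = 0 then 1 else 2)" by simp
    then show "card (?B a \<times> ?W a) = (if rank A a = 0 then 1 else 2) * card (?W a)"
      by (simp add: card_cartesian_product)
  qed
  finally show ?thesis .
qed

lemma bij_betw_rank:
  assumes "finite A"
  shows "bij_betw (rank A) A {..<card A}"
proof -
  have less: "rank A a < rank A b" if "a \<in> A" "a < b" for a b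
    unfolding rank_def using assms that by (intro psubset_card_mono) auto
  have inj: "inj_on (rank A) A"
    by (rule linorder_inj_onI) (use less in force)+
  have "rank A a < card A" if "a \<in> A" for a
    unfolding rank_def using assms that by (intro psubset_card_mono) auto
  then have "rank A ` A \<subseteq> {..<card A}" by auto
  then have "rank A ` A = {..<card A}"
    by (rule card_subset_eq[rotated]) (simp_all add: card_image[OF inj])
  with inj show ?thesis by (simp add: bij_betw_def)
qed

section \<open>The recurrence\<close>

text \<open>
  By the decomposition above, the number of words over \<open>A\<close> depends on \<open>A\<close> only through
  its cardinality. This function gives that number, so that \<open>A - {a}\<close> can be replaced by the
  interval \<open>{1..n}\<close> of the same cardinality.
\<close>

fun over_mahonian_rec :: "nat \<Rightarrow> int \<Rightarrow> nat" where
  "over_mahonian_rec 0 k = (if k = 0 then 1 else 0)"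
| "over_mahonian_rec (Suc n) k =
    (\<Sum>r<Suc n. (if r = 0 then 1 else 2) * over_mahonian_rec n (k - int r))"

lemma card_overlined_perms_of_inv:
  assumes "finite A"
  shows "card (overlined_perms_of_inv A k) = over_mahonian_rec (card A) k"
  using assms
proof (induction "card A" arbitrary: A k)
  case 0
  then have "overlined_perms_of_inv A k = (if k = 0 then {[]} else {})"
    by (auto simp: overlined_perms_of_inv_def overlined_perms_of_def overlines_ok_def
        inversions_def)
  with 0 show ?case by (simp flip: 0(1))
next
  case (Suc n)
  let ?f = "\<lambda>r. (if r = 0 then 1 else 2) * over_mahonian_rec n (k - int r)"
  from Suc have "A \<noteq> {}" by auto
  then have "card (overlined_perms_of_inv A k) =
      (\<Sum>a\<in>A. (if rank A a = 0 then 1 else 2)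
        * card (overlined_perms_of_inv (A - {a}) (k - int (rank A a))))"
    by (rule card_overlined_perms_of_inv_rec[OF Suc.prems])
  also have "\<dots> = (\<Sum>a\<in>A. ?f (rank A a))"
  proof (intro sum.cong refl)
    fix a assume "a \<in> A"
    then have "n = card (A - {a})" using Suc.hyps(2) Suc.prems by simp
    from Suc.hyps(1)[OF this] this
    show "(if rank A a = 0 then 1 else 2)
        * card (overlined_perms_of_inv (A - {a}) (k - int (rank A a))) = ?f (rank A a)"
      using Suc.prems by simp
  qed
  also have "\<dots> = (\<Sum>r<card A. ?f r)"
    by (rule sum.reindex_bij_betw[OF bij_betw_rank[OF Suc.prems]])
  finally show ?case by (simp flip: Suc.hyps(2))
qed

lemma over_mahonian_eq_rec: "over_mahonian n k = over_mahonian_rec n k"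
  by (simp add: over_mahonian_altdef card_overlined_perms_of_inv)

lemma over_mahonian_0: "over_mahonian 0 k = (if k = 0 then 1 else 0)"
  by (simp add: over_mahonian_eq_rec)

theorem over_mahonian_Suc:
  "over_mahonian (Suc n) k = over_mahonian n k + 2 * (\<Sum>r<n. over_mahonian n (k - int (Suc r)))"
  unfolding over_mahonian_eq_rec over_mahonian_rec.simps(2)
  by (subst sum.lessThan_Suc_shift) (simp add: sum_distrib_left)

section \<open>Values of the over-Mahonian numbers\<close>

lemma over_mahonian_neg: "k < 0 \<Longrightarrow> over_mahonian n k = 0"
  by (induction n arbitrary: k) (auto simp: over_mahonian_0 over_mahonian_Suc)

lemma over_mahonian_zero_right: "over_mahonian n 0 = 1"
  by (induction n) (auto simp: over_mahonian_0 over_mahonian_Suc over_mahonian_neg)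

lemma Suc_choose_two: "Suc n choose 2 = n + (n choose 2)"
  by (simp add: numeral_2_eq_2)

lemma over_mahonian_beyond: "k > int (n choose 2) \<Longrightarrow> over_mahonian n k = 0"
proof (induction n arbitrary: k)
  case 0
  then show ?case by (simp add: over_mahonian_0)
next
  case (Suc n)
  then show ?case by (auto simp: over_mahonian_Suc Suc_choose_two)
qed

lemma over_mahonian_max: "over_mahonian (Suc n) (int (Suc n choose 2)) = 2 ^ n"
proof (induction n)
  case 0
  then show ?case by (simp add: over_mahonian_Suc over_mahonian_0)
next
  case (Suc n)
  let ?N = "Suc n" and ?k = "int (Suc (Suc n) choose 2)"
  have k: "?k = int (Suc n) + int (Suc n choose 2)"
    by (simp add: Suc_choose_two)
  \<comment> \<open>A shift by less than \<open>Suc n\<close> leaves the argument beyond the maximal number of inversions.\<close>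
  have "over_mahonian ?N ?k = 0"
    by (rule over_mahonian_beyond) (simp add: k)
  moreover have "over_mahonian ?N (?k - int (Suc r)) = 0" if "r < n" for r
    by (rule over_mahonian_beyond) (use that in \<open>simp add: k\<close>)
  moreover have "over_mahonian ?N (?k - int (Suc n)) = 2 ^ n"
    using Suc.IH by (simp add: k)
  ultimately show ?case
    by (simp only: over_mahonian_Suc[of ?N] sum.lessThan_Suc) simp
qed

lemma over_mahonian_one: "over_mahonian (Suc n) 1 = 2 * n"
proof (induction n)
  case 0
  then show ?case by (simp add: over_mahonian_Suc over_mahonian_0)
next
  case (Suc n)
  have "(\<Sum>r<Suc n. over_mahonian (Suc n) (1 - int (Suc r))) = 1"
    by (simp only: sum.lessThan_Suc_shift)
      (simp add: over_mahonian_zero_right over_mahonian_neg)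
  with Suc.IH show ?case
    by (simp only: over_mahonian_Suc[of "Suc n"]) simp
qed

lemma even_over_mahonian: "k \<noteq> 0 \<Longrightarrow> even (over_mahonian n k)"
  by (induction n) (simp_all add: over_mahonian_0 over_mahonian_Suc)

theorem proposition2p9:
  fixes n :: nat
  assumes "n \<ge> 1"
  shows "over_mahonian n (int (n choose 2)) = 2 ^ (n - 1) \<and>
         over_mahonian n 1 = 2 * (n - 1) \<and>
         (n \<ge> 2 \<longrightarrow> (\<forall>k::int. k \<ge> 1 \<longrightarrow> even (over_mahonian n k)))"
proof -
  from assms obtain m where "n = Suc m" by (cases n) auto
  then show ?thesis
    using over_mahonian_max[of m] over_mahonian_one[of m] even_over_mahonian[of _ n] by auto
qed

end
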